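(* Let $K:V\to\mathfrak g$ be an $\mathcal O$-operator on the differential 3-Lie algebra $(\mathfrak g,d_{\mathfrak g})$ with weight $\lambda$ associated to the representation $(V,\rho,d_V)$. Define $\varrho_K:V\wedge V\to gl(\mathfrak g)$ by $$\varrho_K(u,v)x=[K(u),K(v),x]-K(\rho(Kv,x)u+\rho(x,Ku)v).$$ Then $(\mathfrak g,\varrho_K,d_{\mathfrak g})$ is a representation of the differential 3-Lie algebra $(V,[\cdot,\cdot,\cdot]_K,d_V)$ with weight $\lambda$, where $[u,v,w]_K=\rho(K(u),K(v))w+\rho(K(v),K(w))u+\rho(K(w),K(u))v$.
   Context: $k$ is a field of characteristic 0; all vector spaces are over $k$. A 3-Lie algebra is a vector space $\mathfrak g$ with a skew-symmetric trilinear bracket satisfying $[x_1,x_2,[y_1,y_2,y_3]]=[[x_1,x_2,y_1],y_2,y_3]+[y_1,[x_1,x_2,y_2],y_3]+[y_1,y_2,[x_1,x_2,y_3]]$. A differential 3-Lie algebra with weight $\lambda$ is a 3-Lie algebra with a linear map $d=d_{\mathfrak g}:\mathfrak g\to\mathfrak g$ such that $d[x_1,x_2,x_3]=[dx_1,x_2,x_3]+[x_1,dx_2,x_3]+[x_1,x_2,dx_3]+\lambda[dx_1,dx_2,x_3]+\lambda[x_1,dx_2,dx_3]+\lambda[dx_1,x_2,dx_3]+\lambda^2[dx_1,dx_2,dx_3]$. A representation of a 3-Lie algebra $\mathfrak g$ is a vector space $V$ with a skew-symmetric bilinear map $\rho:\mathfrak g\wedge\mathfrak g\to gl(V)$ such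 that $\rho(x_1,x_2)\rho(x_3,x_4)=\rho([x_1,x_2,x_3],x_4)+\rho(x_3,[x_1,x_2,x_4])+\rho(x_3,x_4)\rho(x_1,x_2)$ and $\rho(x_1,[x_2,x_3,x_4])=\rho(x_3,x_4)\rho(x_1,x_2)-\rho(x_2,x_4)\rho(x_1,x_3)+\rho(x_2,x_3)\rho(x_1,x_4)$. A representation $(V,\rho,d_V)$ of $(\mathfrak g,d)$ has in addition a linear $d_V:V\to V$ with $d_V\rho(x_1,x_2)=\rho(dx_1,x_2)+\rho(x_1,dx_2)+\lambda\rho(dx_1,dx_2)+\rho(x_1,x_2)d_V+\lambda(\rho(dx_1,x_2)+\rho(x_1,dx_2)+\lambda\rho(dx_1,dx_2))d_V$. An $\mathcal O$-operator on $(\mathfrak g,d_{\mathfrak g})$ associated to $(V,\rho,d_V)$ is a linear map $K:V\to\mathfrak g$ with $Kd_V=d_{\mathfrak g}K$ and $[K(u),K(v),K(w)]=K\big(\rho(K(u),K(v))w+\rho(K(v),K(w))u+\rho(K(w),K(u))v\big)$ for all $u,v,w\in V$. For such $K$, $(V,[\cdot,\cdot,\cdot]_K,d_V)$ is a differential 3-Lie algebra with weight $\lambda$. *)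

theory Defs
  imports Complex_Main
begin

text \<open>
  A vector space over a field of characteristic 0 is the library locale \<^locale>\<open>vector_space\<close>,
  given by its scalar multiplication on a whole type. The weight is an arbitrary scalar \<open>wt\<close>.
\<close>

text \<open>
  Skew symmetry is imposed for the two adjacent transpositions; these generate the symmetric
  group, so the bracket changes by the sign under every permutation of its arguments.
  Together with it, linearity in the last argument would imply linearity in the other two.
\<close>
locale three_lie_algebra = vector_space scale
  for scale :: "'k::field_char_0 \<Rightarrow> 'g::ab_group_add \<Rightarrow> 'g" +
  fixes br :: "'g \<Rightarrow> 'g \<Rightarrow> 'g \<Rightarrow> 'g"
  assumes br_linear1: "Vector_Spaces.linear scale scale (\<lambda>x. br x y z)"
    and br_linear2: "Vector_Spaces.linear scale scale (\<lambda>y. br x y z)"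
    and br_linear3: "Vector_Spaces.linear scale scale (\<lambda>z. br x y z)"
    and br_skew12: "br y x z = - br x y z"
    and br_skew23: "br x z y = - br x y z"
    and fundamental_identity:
      "br x1 x2 (br y1 y2 y3) =
        br (br x1 x2 y1) y2 y3 + br y1 (br x1 x2 y2) y3 + br y1 y2 (br x1 x2 y3)"

locale differential_three_lie_algebra = three_lie_algebra scale br
  for scale :: "'k::field_char_0 \<Rightarrow> 'g::ab_group_add \<Rightarrow> 'g"
    and br :: "'g \<Rightarrow> 'g \<Rightarrow> 'g \<Rightarrow> 'g" +
  fixes d :: "'g \<Rightarrow> 'g" and wt :: 'k
  assumes d_linear: "Vector_Spaces.linear scale scale d"
    and d_br:
      "d (br x1 x2 x3) =
        br (d x1) x2 x3 + br x1 (d x2) x3 + br x1 x2 (d x3)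
        + scale wt (br (d x1) (d x2) x3)
        + scale wt (br x1 (d x2) (d x3))
        + scale wt (br (d x1) x2 (d x3))
        + scale (wt\<^sup>2) (br (d x1) (d x2) (d x3))"

text \<open>
  The map \<open>\<rho> : \<gg> \<and> \<gg> \<rightarrow> gl(V)\<close> is a curried skew-symmetric bilinear map whose values
  are linear endomorphisms of \<open>V\<close>; identities between endomorphisms are stated pointwise.
\<close>
locale three_lie_representation =
  three_lie_algebra scaleG br + V: vector_space scaleV
  for scaleG :: "'k::field_char_0 \<Rightarrow> 'g::ab_group_add \<Rightarrow> 'g"
    and br :: "'g \<Rightarrow> 'g \<Rightarrow> 'g \<Rightarrow> 'g"
    and scaleV :: "'k \<Rightarrow> 'v::ab_group_add \<Rightarrow> 'v" +
  fixes \<rho> :: "'g \<Rightarrow> 'g \<Rightarrow> 'v \<Rightarrow> 'v"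
  assumes rho_endo: "Vector_Spaces.linear scaleV scaleV (\<rho> x y)"
    and rho_linear1: "Vector_Spaces.linear scaleG scaleV (\<lambda>x. \<rho> x y v)"
    and rho_linear2: "Vector_Spaces.linear scaleG scaleV (\<lambda>y. \<rho> x y v)"
    and rho_skew: "\<rho> y x v = - \<rho> x y v"
    and rho_rho:
      "\<rho> x1 x2 (\<rho> x3 x4 v) =
        \<rho> (br x1 x2 x3) x4 v + \<rho> x3 (br x1 x2 x4) v + \<rho> x3 x4 (\<rho> x1 x2 v)"
    and rho_br:
      "\<rho> x1 (br x2 x3 x4) v =
        \<rho> x3 x4 (\<rho> x1 x2 v) - \<rho> x2 x4 (\<rho> x1 x3 v) + \<rho> x2 x3 (\<rho> x1 x4 v)"

locale differential_three_lie_representation =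
  differential_three_lie_algebra scaleG br d wt +
  three_lie_representation scaleG br scaleV \<rho>
  for scaleG :: "'k::field_char_0 \<Rightarrow> 'g::ab_group_add \<Rightarrow> 'g"
    and br :: "'g \<Rightarrow> 'g \<Rightarrow> 'g \<Rightarrow> 'g"
    and d :: "'g \<Rightarrow> 'g"
    and wt :: 'k
    and scaleV :: "'k \<Rightarrow> 'v::ab_group_add \<Rightarrow> 'v"
    and \<rho> :: "'g \<Rightarrow> 'g \<Rightarrow> 'v \<Rightarrow> 'v" +
  fixes dV :: "'v \<Rightarrow> 'v"
  assumes dV_linear: "Vector_Spaces.linear scaleV scaleV dV"
    and dV_rho:
      "dV (\<rho> x1 x2 v) =
        \<rho> (d x1) x2 v + \<rho> x1 (d x2) v + scaleV wt (\<rho> (d x1) (d x2) v)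
        + \<rho> x1 x2 (dV v)
        + scaleV wt
            (\<rho> (d x1) x2 (dV v) + \<rho> x1 (d x2) (dV v) + scaleV wt (\<rho> (d x1) (d x2) (dV v)))"

definition bracket_K ::
  "('g \<Rightarrow> 'g \<Rightarrow> 'v \<Rightarrow> 'v) \<Rightarrow> ('v \<Rightarrow> 'g) \<Rightarrow> 'v \<Rightarrow> 'v \<Rightarrow> 'v \<Rightarrow> 'v::ab_group_add"
  where "bracket_K \<rho> K u v w = \<rho> (K u) (K v) w + \<rho> (K v) (K w) u + \<rho> (K w) (K u) v"

definition varrho_K ::
  "('g \<Rightarrow> 'g \<Rightarrow> 'g \<Rightarrow> 'g) \<Rightarrow> ('g \<Rightarrow> 'g \<Rightarrow> 'v \<Rightarrow> 'v) \<Rightarrow> ('v \<Rightarrow> 'g)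
    \<Rightarrow> 'v::ab_group_add \<Rightarrow> 'v \<Rightarrow> 'g \<Rightarrow> 'g::ab_group_add"
  where "varrho_K br \<rho> K u v x = br (K u) (K v) x - K (\<rho> (K v) x u + \<rho> x (K u) v)"

locale O_operator =
  differential_three_lie_representation scaleG br d wt scaleV \<rho> dV
  for scaleG :: "'k::field_char_0 \<Rightarrow> 'g::ab_group_add \<Rightarrow> 'g"
    and br :: "'g \<Rightarrow> 'g \<Rightarrow> 'g \<Rightarrow> 'g"
    and d :: "'g \<Rightarrow> 'g"
    and wt :: 'k
    and scaleV :: "'k \<Rightarrow> 'v::ab_group_add \<Rightarrow> 'v"
    and \<rho> :: "'g \<Rightarrow> 'g \<Rightarrow> 'v \<Rightarrow> 'v"
    and dV :: "'v \<Rightarrow> 'v" +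
  fixes K :: "'v \<Rightarrow> 'g"
  assumes K_linear: "Vector_Spaces.linear scaleV scaleG K"
    and K_dV: "K (dV v) = d (K v)"
    and br_K:
      "br (K u) (K v) (K w) = K (\<rho> (K u) (K v) w + \<rho> (K v) (K w) u + \<rho> (K w) (K u) v)"

end

theory Submission imports Defs "HOL-Library.Product_Plus" begin

text \<open>
  The semidirect product \<open>\<gg> \<ltimes> V\<close> is a differential 3-Lie algebra, and \<open>K\<close> is an
  \<open>O\<close>-operator precisely when its graph \<open>{(K u, u)}\<close> is a differential subalgebra. The graph is
  a copy of \<open>V\<close> with the bracket \<open>[\<cdot>,\<cdot>,\<cdot>]\<^sub>K\<close>, and its adjoint action descends to the
  quotient by the graph. Identifying this quotient with \<open>\<gg>\<close> via \<open>(x, u) \<mapsto> x - K u\<close>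
  turns the action into \<open>varrho_K\<close>.
\<close>

section \<open>The bracket and its adjoint action\<close>

context three_lie_algebra
begin

lemma br_add:
  "br (x + x') y z = br x y z + br x' y z"
  "br x (y + y') z = br x y z + br x y' z"
  "br x y (z + z') = br x y z + br x y z'"
  using br_linear1 br_linear2 br_linear3 by (simp_all add: Vector_Spaces.linear_iff)

lemma br_scale:
  "br (scale c x) y z = scale c (br x y z)"
  "br x (scale c y) z = scale c (br x y z)"
  "br x y (scale c z) = scale c (br x y z)"
  using br_linear1 br_linear2 br_linear3 by (simp_all add: Vector_Spaces.linear_iff)

lemma br_minus:
  "br (- x) y z = - br x y z"
  "br x (- y) z = - br x y z"
  "br x y (- z) = - br x y z"
  using br_scale[where c = "- 1"] by simp_all

lemma br_rotate: "br y z x = br x y z"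
  by (metis br_skew12 br_skew23)

text \<open>This is the axiom \<open>rho_br\<close> for the adjoint action. Skew symmetry moves the
  nested bracket into the last slot, where the fundamental identity says that bracketing with
  \<open>x1\<close> and \<open>y\<close> is a derivation; reordering the three resulting terms
  produces the signs.\<close>

lemma adjoint_br:
  "br x1 (br x2 x3 x4) y =
    br x3 x4 (br x1 x2 y) - br x2 x4 (br x1 x3 y) + br x2 x3 (br x1 x4 y)"
proof -
  have "br x1 (br x2 x3 x4) y = - br x1 y (br x2 x3 x4)"
    by (rule br_skew23)
  also have "\<dots> = - (br (br x1 y x2) x3 x4 + br x2 (br x1 y x3) x4 + br x2 x3 (br x1 y x4))"
    by (simp only: fundamental_identity[of x1 y])
  also have "\<dots> = br (br x1 x2 y) x3 x4 + br x2 (br x1 x3 y) x4 + br x2 x3 (br x1 x4 y)"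
    by (simp add: br_skew23[of x1 y x2] br_skew23[of x1 y x3] br_skew23[of x1 y x4] br_minus)
  also have "br (br x1 x2 y) x3 x4 = br x3 x4 (br x1 x2 y)"
    by (rule br_rotate[symmetric])
  also have "br x2 (br x1 x3 y) x4 = - br x2 x4 (br x1 x3 y)"
    by (rule br_skew23)
  finally show ?thesis by simp
qed

end

section \<open>Subalgebras and their action on a quotient\<close>

lemma three_lie_subalgebra:
  assumes E: "three_lie_algebra sE brE"
    and \<iota>: "Vector_Spaces.linear sV sE \<iota>" "inj \<iota>"
    and \<iota>_br: "\<And>u v w. \<iota> (brV u v w) = brE (\<iota> u) (\<iota> v) (\<iota> w)"
  shows "three_lie_algebra sV brV"
proof -
  interpret E: three_lie_algebra sE brE by (fact E)
  interpret \<iota>: Vector_Spaces.linear sV sE \<iota> by (fact \<iota>(1))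
  note [simp] = \<iota>_br \<iota>.add \<iota>.scale \<iota>.neg
  \<comment> \<open>Every axiom for \<open>brV\<close> is an equation in the domain of
    \<open>\<iota>\<close>: its image is the corresponding equation for \<open>brE\<close>, and
    injectivity cancels \<open>\<iota>\<close>.\<close>
  have eqI: "a = b" if "\<iota> a = \<iota> b" for a b
    using \<iota>(2) that by (rule injD)
  show ?thesis
  proof (rule three_lie_algebra.intro[OF \<iota>.vs1.vector_space_axioms],
      rule three_lie_algebra_axioms.intro, unfold Vector_Spaces.linear_iff, goal_cases)
    case (4 y x z)
    show ?case by (rule eqI) (simp add: E.br_skew12[of "\<iota> x"])
  next
    case (5 x z y)
    show ?case by (rule eqI) (simp add: E.br_skew23[of "\<iota> x" "\<iota> z"])
  next
    case (6 x1 x2 y1 y2 y3)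
    show ?case by (rule eqI) (simp add: E.fundamental_identity[of "\<iota> x1"])
  qed (auto intro!: eqI simp: \<iota>.vs1.vector_space_axioms E.br_add E.br_scale)
qed

lemma differential_three_lie_subalgebra:
  assumes E: "differential_three_lie_algebra sE brE dE wt"
    and \<iota>: "Vector_Spaces.linear sV sE \<iota>" "inj \<iota>"
    and \<iota>_br: "\<And>u v w. \<iota> (brV u v w) = brE (\<iota> u) (\<iota> v) (\<iota> w)"
    and \<iota>_d: "\<And>u. \<iota> (dV u) = dE (\<iota> u)"
  shows "differential_three_lie_algebra sV brV dV wt"
proof -
  interpret E: differential_three_lie_algebra sE brE dE wt by (fact E)
  interpret \<iota>: Vector_Spaces.linear sV sE \<iota> by (fact \<iota>(1))
  interpret dE: Vector_Spaces.linear sE sE dE by (fact E.d_linear)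
  interpret V: three_lie_algebra sV brV
    using E.three_lie_algebra_axioms \<iota> \<iota>_br by (rule three_lie_subalgebra[where \<iota> = \<iota> and brV = brV and brE = brE])
  have eqI: "a = b" if "\<iota> a = \<iota> b" for a b
    using \<iota>(2) that by (rule injD)
  show ?thesis
  proof (rule differential_three_lie_algebra.intro[OF V.three_lie_algebra_axioms],
      rule differential_three_lie_algebra_axioms.intro, unfold Vector_Spaces.linear_iff, goal_cases)
    case 1
    show ?case
      by (auto intro!: eqI simp: \<iota>.vs1.vector_space_axioms \<iota>.add \<iota>.scale \<iota>_d dE.add dE.scale)
  next
    case (2 x1 x2 x3)
    show ?case
      by (rule eqI) (simp only: \<iota>_d \<iota>_br \<iota>.add \<iota>.scale E.d_br)
  qed
qed

text \<open>
  Instantiated with \<open>\<pi>\<close> the projection of an algebra onto its quotient by the subalgebra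
  \<open>\<iota>(V)\<close>. The adjoint identities hold exactly in the ambient algebra, so it is enough that
  the action descends along \<open>\<pi>\<close>.
\<close>
lemma differential_quotient_representation:
  assumes E: "differential_three_lie_algebra sE brE dE wt"
    and \<iota>: "Vector_Spaces.linear sV sE \<iota>" "inj \<iota>"
    and \<iota>_br: "\<And>u v w. \<iota> (brV u v w) = brE (\<iota> u) (\<iota> v) (\<iota> w)"
    and \<iota>_d: "\<And>u. \<iota> (dV u) = dE (\<iota> u)"
    and \<pi>: "Vector_Spaces.linear sE sG \<pi>" "surj \<pi>"
    and \<pi>_d: "\<And>e. dG (\<pi> e) = \<pi> (dE e)"
    and \<rho>: "\<And>u v e. \<rho> u v (\<pi> e) = \<pi> (brE (\<iota> u) (\<iota> v) e)"
  shows "differential_three_lie_representation sV brV dV wt sG \<rho> dG"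
proof -
  interpret E: differential_three_lie_algebra sE brE dE wt by (fact E)
  interpret \<iota>: Vector_Spaces.linear sV sE \<iota> by (fact \<iota>(1))
  interpret \<pi>: Vector_Spaces.linear sE sG \<pi> by (fact \<pi>(1))
  interpret dE: Vector_Spaces.linear sE sE dE by (fact E.d_linear)
  interpret V: differential_three_lie_algebra sV brV dV wt
    using E \<iota> \<iota>_br \<iota>_d
      by (rule differential_three_lie_subalgebra[where \<iota> = \<iota> and brV = brV and brE = brE
            and dV = dV and dE = dE])
  \<comment> \<open>\<open>\<rho>\<close> and \<open>dG\<close> are given as functions on the
    quotient, so well-definedness is already part of the hypotheses; each identity only has to be
    checked on a representative \<open>e\<close>.\<close>
  have lift: "\<exists>e. x = \<pi> e" for x
    using \<pi>(2) by (rule surjD)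
  have \<rho>_endo: "Vector_Spaces.linear sG sG (\<rho> u v)" for u v
    unfolding Vector_Spaces.linear_iff
  proof (intro conjI allI)
    fix x y c
    obtain e f where ef: "x = \<pi> e" "y = \<pi> f" using lift by meson
    show "\<rho> u v (x + y) = \<rho> u v x + \<rho> u v y"
      by (simp add: ef \<rho> E.br_add flip: \<pi>.add)
    show "\<rho> u v (sG c x) = sG c (\<rho> u v x)"
      by (simp add: ef \<rho> E.br_scale flip: \<pi>.scale)
  qed (fact \<pi>.vs2.vector_space_axioms)+
  have dG_linear: "Vector_Spaces.linear sG sG dG"
    unfolding Vector_Spaces.linear_iff
  proof (intro conjI allI)
    fix x y c
    obtain e f where ef: "x = \<pi> e" "y = \<pi> f" using lift by meson
    show "dG (x + y) = dG x + dG y"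
      by (simp add: ef \<pi>_d dE.add flip: \<pi>.add)
    show "dG (sG c x) = sG c (dG x)"
      by (simp add: ef \<pi>_d dE.scale flip: \<pi>.scale)
  qed (fact \<pi>.vs2.vector_space_axioms)+
  show ?thesis
  proof (intro differential_three_lie_representation.intro three_lie_representation.intro
      three_lie_representation_axioms.intro differential_three_lie_representation_axioms.intro
      V.differential_three_lie_algebra_axioms V.three_lie_algebra_axioms
      \<pi>.vs2.vector_space_axioms, goal_cases)
    case (1 u v)
    show ?case by (fact \<rho>_endo)
  next
    case (2 v x)
    obtain e where "x = \<pi> e" using lift by meson
    then show ?case
      by (simp add: Vector_Spaces.linear_iff \<iota>.vs1.vector_space_axioms \<pi>.vs2.vector_space_axioms
          \<rho> \<iota>.add \<iota>.scale E.br_add E.br_scale \<pi>.add \<pi>.scale)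
  next
    case (3 u x)
    obtain e where "x = \<pi> e" using lift by meson
    then show ?case
      by (simp add: Vector_Spaces.linear_iff \<iota>.vs1.vector_space_axioms \<pi>.vs2.vector_space_axioms
          \<rho> \<iota>.add \<iota>.scale E.br_add E.br_scale \<pi>.add \<pi>.scale)
  next
    case (4 v u x)
    obtain e where "x = \<pi> e" using lift by meson
    then show ?case by (simp add: \<rho> E.br_skew12[of "\<iota> u"] \<pi>.neg)
  next
    case (5 u1 u2 u3 u4 x)
    obtain e where "x = \<pi> e" using lift by meson
    then show ?case
      by (simp only: \<rho> \<iota>_br E.fundamental_identity[of "\<iota> u1" "\<iota> u2" "\<iota> u3"] \<pi>.add)
  next
    case (6 u1 u2 u3 u4 x)
    obtain e where "x = \<pi> e" using lift by meson
    then show ?case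
      by (simp only: \<rho> \<iota>_br E.adjoint_br[of "\<iota> u1"] \<pi>.add \<pi>.diff)
  next
    case 7
    show ?case by (fact dG_linear)
  next
    \<comment> \<open>Apply \<open>\<pi>\<close> to \<open>E.d_br\<close> with \<open>e\<close> in
      the third slot: its seven terms are those of the compatibility law between \<open>dG\<close>
      and \<open>\<rho>\<close>, up to grouping of the weights.\<close>
    case (8 u v x)
    obtain e where "x = \<pi> e" using lift by meson
    then show ?case
      by (simp add: \<rho> \<pi>_d \<iota>_d E.d_br \<pi>.add \<pi>.scale \<pi>.vs2.scale_right_distrib
          power2_eq_square)
  qed
qed

section \<open>The semidirect product\<close>

context differential_three_lie_representation
begin

definition semi_scale :: "'k \<Rightarrow> 'g \<times> 'v \<Rightarrow> 'g \<times> 'v"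
  where "semi_scale c = map_prod (scaleG c) (scaleV c)"

text \<open>The copy of V is an abelian ideal: a bracket with two entries from V vanishes. The
  cyclic order of the arguments in the second component makes the bracket skew-symmetric.\<close>

definition semi_br :: "'g \<times> 'v \<Rightarrow> 'g \<times> 'v \<Rightarrow> 'g \<times> 'v \<Rightarrow> 'g \<times> 'v"
  where "semi_br X Y Z =
    (br (fst X) (fst Y) (fst Z),
     \<rho> (fst X) (fst Y) (snd Z) + \<rho> (fst Y) (fst Z) (snd X) + \<rho> (fst Z) (fst X) (snd Y))"

lemma rho_add:
  "\<rho> (x + x') y v = \<rho> x y v + \<rho> x' y v"
  "\<rho> x (y + y') v = \<rho> x y v + \<rho> x y' v"
  "\<rho> x y (v + v') = \<rho> x y v + \<rho> x y v'"
  using rho_linear1 rho_linear2 rho_endo by (simp_all add: Vector_Spaces.linear_iff)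

lemma rho_scale:
  "\<rho> (scaleG c x) y v = scaleV c (\<rho> x y v)"
  "\<rho> x (scaleG c y) v = scaleV c (\<rho> x y v)"
  "\<rho> x y (scaleV c v) = scaleV c (\<rho> x y v)"
  using rho_linear1 rho_linear2 rho_endo by (simp_all add: Vector_Spaces.linear_iff)

text \<open>Skew symmetry absorbs the signs of \<open>rho_br\<close>, giving the cyclic shape in
  which such terms occur in \<open>semi_br\<close>.\<close>

lemma rho_br1:
  "\<rho> (br x2 x3 x4) x1 v =
    \<rho> x3 x4 (\<rho> x2 x1 v) + \<rho> x4 x2 (\<rho> x3 x1 v) + \<rho> x2 x3 (\<rho> x4 x1 v)"
proof -
  have minus: "\<rho> x y (- w) = - \<rho> x y w" for x y w
    using rho_scale(3)[where c = "- 1"] by simp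
  show ?thesis
    unfolding rho_skew[of "br x2 x3 x4"] rho_br rho_skew[of x4 x2] rho_skew[of _ x1]
    by (simp add: minus)
qed

lemma semi_vector_space: "vector_space semi_scale"
  by unfold_locales
    (auto simp: semi_scale_def scale_right_distrib scale_left_distrib
      V.scale_right_distrib V.scale_left_distrib)

lemma semi_three_lie_algebra: "three_lie_algebra semi_scale semi_br"
proof (rule three_lie_algebra.intro[OF semi_vector_space],
    rule three_lie_algebra_axioms.intro, unfold Vector_Spaces.linear_iff, goal_cases)
  case (4 Y X Z)
  show ?case
    by (simp add: semi_br_def br_skew12[of "fst X"] rho_skew[of "fst X" "fst Y"]
        rho_skew[of "fst Y" "fst Z"] rho_skew[of "fst Z" "fst X"])
next
  case (5 X Z Y)
  show ?case
    by (simp add: semi_br_def br_skew23[of "fst X" "fst Y"] rho_skew[of "fst X" "fst Y"]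
        rho_skew[of "fst Y" "fst Z"] rho_skew[of "fst Z" "fst X"])
next
  case (6 X1 X2 Y1 Y2 Y3)
  obtain x1 u1 x2 u2 y1 v1 y2 v2 y3 v3 where
    X: "X1 = (x1, u1)" "X2 = (x2, u2)" "Y1 = (y1, v1)" "Y2 = (y2, v2)" "Y3 = (y3, v3)"
    by (metis surj_pair)
  \<comment> \<open>The V-component of the fundamental identity splits by the vector acted on: terms
    in \<open>v1\<close>, \<open>v2\<close>, \<open>v3\<close> match by \<open>rho_rho\<close>,
    those in \<open>u1\<close> by this cyclic form of \<open>rho_br\<close>, those in
    \<open>u2\<close> by \<open>rho_br1\<close>.\<close>
  have u1: "\<rho> x2 (br y1 y2 y3) u1 =
      \<rho> y2 y3 (\<rho> x2 y1 u1) + \<rho> y3 y1 (\<rho> x2 y2 u1) + \<rho> y1 y2 (\<rho> x2 y3 u1)"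
    by (simp add: rho_br rho_skew[of y3 y1])
  show ?case
    unfolding X semi_br_def fst_conv snd_conv prod.inject plus_prod_def
    by (simp add: fundamental_identity[of x1 x2] u1 rho_add rho_rho[of x1 x2]
        rho_br1[of y1 y2 y3 x1])
qed (simp_all add: semi_vector_space semi_br_def semi_scale_def br_add br_scale rho_add rho_scale
    V.scale_right_distrib)

lemma semi_differential:
  "differential_three_lie_algebra semi_scale semi_br (map_prod d dV) wt"
proof (rule differential_three_lie_algebra.intro[OF semi_three_lie_algebra],
    rule differential_three_lie_algebra_axioms.intro, goal_cases)
  case 1
  show ?case
    using d_linear dV_linear semi_vector_space by (auto simp: Vector_Spaces.linear_iff semi_scale_def)
next
  case (2 X1 X2 X3)
  have dV_add: "dV (a + b) = dV a + dV b" for a b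
    using dV_linear by (simp add: Vector_Spaces.linear_iff)
  show ?case
    \<comment> \<open>\<open>dV_rho\<close> is \<open>d_br\<close> with its third argument taken
      from V, so it settles each of the three cyclic summands of the V-component, as
      \<open>d_br\<close> settles the other component.\<close>
    by (simp add: prod_eq_iff semi_br_def semi_scale_def d_br dV_add dV_rho
        V.scale_right_distrib power2_eq_square add_ac)
qed

end

section \<open>The graph of K and the quotient by it\<close>

theorem proposition4p8:
  fixes scaleG :: "'k::field_char_0 \<Rightarrow> 'g::ab_group_add \<Rightarrow> 'g"
    and br :: "'g \<Rightarrow> 'g \<Rightarrow> 'g \<Rightarrow> 'g"
    and dG :: "'g \<Rightarrow> 'g"
    and wt :: 'k
    and scaleV :: "'k \<Rightarrow> 'v::ab_group_add \<Rightarrow> 'v"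
    and \<rho> :: "'g \<Rightarrow> 'g \<Rightarrow> 'v \<Rightarrow> 'v"
    and dV :: "'v \<Rightarrow> 'v"
    and K :: "'v \<Rightarrow> 'g"
  assumes "O_operator scaleG br dG wt scaleV \<rho> dV K"
  shows "differential_three_lie_representation
    scaleV (bracket_K \<rho> K) dV wt scaleG (varrho_K br \<rho> K) dG"
proof -
  interpret O_operator scaleG br dG wt scaleV \<rho> dV K by (fact assms)
  interpret K: Vector_Spaces.linear scaleV scaleG K by (fact K_linear)
  interpret dG: Vector_Spaces.linear scaleG scaleG dG by (fact d_linear)
  define \<iota> where "\<iota> u = (K u, u)" for u
  define \<pi> where "\<pi> = (\<lambda>(x, u). x - K u)"
  show ?thesis
  proof (rule differential_quotient_representation[OF semi_differential, where \<iota> = \<iota> and \<pi> = \<pi>])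
    show "Vector_Spaces.linear scaleV semi_scale \<iota>"
      by (simp add: Vector_Spaces.linear_iff V.vector_space_axioms semi_vector_space \<iota>_def semi_scale_def
          K.add K.scale)
    show "inj \<iota>"
      by (simp add: inj_def \<iota>_def)
    \<comment> \<open>The second components agree by definition of the bracket; equality of the
      first components is the operator identity \<open>br_K\<close>.\<close>
    show "\<iota> (bracket_K \<rho> K u v w) = semi_br (\<iota> u) (\<iota> v) (\<iota> w)" for u v w
      by (simp add: \<iota>_def semi_br_def bracket_K_def br_K)
    show "\<iota> (dV u) = map_prod dG dV (\<iota> u)" for u
      by (simp add: \<iota>_def K_dV)
    show "Vector_Spaces.linear semi_scale scaleG \<pi>"
      by (auto simp: Vector_Spaces.linear_iff vector_space_axioms semi_vector_space \<pi>_def semi_scale_def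
          K.add K.scale scale_right_diff_distrib)
    show "surj \<pi>"
      by (rule surjI[where f = "\<lambda>x. (x, 0)"]) (simp add: \<pi>_def K.zero)
    show "dG (\<pi> e) = \<pi> (map_prod dG dV e)" for e
      by (cases e) (simp add: \<pi>_def K_dV dG.diff)
    show "varrho_K br \<rho> K u v (\<pi> e) = \<pi> (semi_br (\<iota> u) (\<iota> v) e)" for u v e
    proof (cases e)
      case (Pair x w)
      \<comment> \<open>Since \<open>\<pi> (x, w)\<close> is \<open>x - K w\<close>, additivity
        separates the contributions of \<open>x\<close> and \<open>w\<close>.\<close>
      have "varrho_K br \<rho> K u v (y + z) = varrho_K br \<rho> K u v y + varrho_K br \<rho> K u v z" for y z
        by (simp add: varrho_K_def br_add rho_add K.add)
      from this[of "x - K w" "K w"]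
      have "varrho_K br \<rho> K u v (x - K w) = varrho_K br \<rho> K u v x - varrho_K br \<rho> K u v (K w)"
        by simp
      \<comment> \<open>By \<open>br_K\<close>, the correction term in \<open>varrho_K\<close>
        cancels two of the three cyclic summands. What remains is the image under \<open>K\<close>
        of the summand of \<open>semi_br\<close> that involves \<open>w\<close>.\<close>
      also have "varrho_K br \<rho> K u v (K w) = K (\<rho> (K u) (K v) w)"
        by (simp add: varrho_K_def br_K K.add)
      finally show ?thesis
        by (simp add: Pair \<pi>_def \<iota>_def semi_br_def varrho_K_def K.add)
    qed
  qed
qed

end
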